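(* Let $d\ge 2$ be an integer, let $\mu$ be a Radon measure on $\mathsf{T}_d$ such that, for some $\sigma\ge 1/d$, $$|\widehat{\mu}(\boldsymbol{\xi})|\ll (1+\|\boldsymbol{\xi}\|)^{-\sigma}\qquad\text{for all } \boldsymbol{\xi}\in\mathbb{R}^d,$$ and let $\mathbf{a}=(a_n)_{n=1}^\infty$ be a sequence of complex numbers with $a_n=n^{o(1)}$ as $n\to\infty$. Then $$\int_{\mathsf{T}_d}|S_{\mathbf{a},d}(\mathbf{x};N)|^2\,d\mu(\mathbf{x})\le N^{1+o(1)},\qquad N\to\infty.$$
   Context: $\mathsf{T}_d=(\mathbb{R}/\mathbb{Z})^d$ is the unit torus, identified with the half-open cube $[0,1)^d$; a Radon measure $\mu$ on $\mathsf{T}_d$ is a (nonnegative) Borel measure with $\mu(\mathsf{T}_d)<\infty$, regarded also as a measure on $\mathbb{R}^d$. Write $\mathbf{e}(x)=\exp(2\pi i x)$. The Fourier transform is $\widehat{\mu}(\boldsymbol{\xi})=\int_{\mathbb{R}^d}\mathbf{e}(-\mathbf{x}\cdot\boldsymbol{\xi})\,d\mu(\mathbf{x})$, and $\|\cdot\|$ is the Euclidean norm. For $\mathbf{x}=(x_1,\dots,x_d)$ and $N\in\mathbb{N}$, $S_{\mathbf{a},d}(\mathbf{x};N)=\sum_{n=1}^N a_n\,\mathbf{e}(x_1n+x_2n^2+\ldots+x_dn^d)$. $U\ll V$ means $|U|\le cV$ for some constant $c>0$ (independent of $\boldsymbol{\xi}$ here). $U=V^{o(1)}$ means that for every $\varepsilon>0$,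 $|U|\le V^{\varepsilon}$ once $V$ is large enough; accordingly $A(N)\le N^{c+o(1)}$ means that for every $\varepsilon>0$, $A(N)\le N^{c+\varepsilon}$ for all sufficiently large $N$. *)

theory Defs
  imports "HOL-Analysis.Analysis"
begin

definition unit_exp :: "real \<Rightarrow> complex" where
  "unit_exp x = exp (2 * of_real pi * \<i> * of_real x)"

definition unit_cube :: "(real ^ 'd) set" where
  "unit_cube = {x. \<forall>i. 0 \<le> x $ i \<and> x $ i < 1}"

text \<open>
  The torus is identified with the half-open unit cube. A Radon measure on it is regarded as a
  finite Borel measure on the ambient Euclidean space that is concentrated on that cube.
\<close>

definition radon_measure_on_torus :: "(real ^ 'd) measure \<Rightarrow> bool" where
  "radon_measure_on_torus \<mu> \<longleftrightarrow>
     sets \<mu> = sets borel \<and> emeasure \<mu> UNIV < \<infinity> \<and> emeasure \<mu> (- unit_cube) = 0"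

definition fourier_transform :: "(real ^ 'd) measure \<Rightarrow> real ^ 'd \<Rightarrow> complex" where
  "fourier_transform \<mu> \<xi> = (LINT x|\<mu>. unit_exp (- (x \<bullet> \<xi>)))"

text \<open>
  An index type carries no numbering of its own, so the numbering of the coordinates is passed as
  a function \<open>idx\<close>: the coordinate written $x_j$ on paper is \<open>x $ idx j\<close>, where \<open>idx\<close> maps
  \<open>{1..CARD('d)}\<close> bijectively onto the index type.
\<close>

definition weyl_sum :: "(nat \<Rightarrow> 'd) \<Rightarrow> (nat \<Rightarrow> complex) \<Rightarrow> real ^ 'd \<Rightarrow> nat \<Rightarrow> complex" where
  "weyl_sum idx a x N =
     (\<Sum>n = 1..N. a n * unit_exp (\<Sum>j = 1..CARD('d). x $ idx j * real n ^ j))"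

definition is_pow_o1 :: "(nat \<Rightarrow> complex) \<Rightarrow> bool" where
  "is_pow_o1 a \<longleftrightarrow> (\<forall>\<epsilon>>0. \<forall>\<^sub>F n in sequentially. cmod (a n) \<le> real n powr \<epsilon>)"

definition le_pow_plus_o1 :: "(nat \<Rightarrow> real) \<Rightarrow> real \<Rightarrow> bool" where
  "le_pow_plus_o1 A c \<longleftrightarrow> (\<forall>\<epsilon>>0. \<forall>\<^sub>F N in sequentially. A N \<le> real N powr (c + \<epsilon>))"

end

theory Submission
  imports Defs
begin

text \<open>
  Expanding the square turns the integral into a double sum over $m, n$ of
  $a_m \overline{a_n}$ times $\widehat\mu$ at a difference of two points of the moment curve. Its
  last coordinate alone gives norm at least $|m^d - n^d| \ge |m - n| \max(m,n)^{d-1}$, so the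
  decay with exponent $1/d$ makes the part with $\max(m,n) = M$ contribute
  $O(M^{-(d-1)/d} \sum_{k \le M} k^{-1/d}) = O(1)$.
\<close>

section \<open>Partial sums of negative powers\<close>

lemma sum_inverse_sqrt_le: "(\<Sum>k = 1..m. 1 / sqrt (real k)) \<le> 2 * sqrt (real m)"
proof (induction m)
  case 0
  show ?case by simp
next
  case (Suc m)
  let ?a = "sqrt (real m)" and ?b = "sqrt (real (Suc m))"
  have b: "?b > 0" by simp
  \<comment> \<open>Since \<open>?b\<close> squared exceeds \<open>?a\<close> squared by 1, dividing
    this inequality by \<open>?b\<close> gives 1/\<open>?b\<close> \<le> 2(\<open>?b\<close> -
    \<open>?a\<close>), so the sum telescopes.\<close>
  have "2 * ?a * ?b \<le> ?a\<^sup>2 + ?b\<^sup>2"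
    by (rule sum_squares_bound)
  then have "2 * ?a * ?b + 1 \<le> 2 * (?b * ?b)"
    by (simp del: of_nat_Suc) simp
  then have "2 * ?a + 1 / ?b \<le> 2 * ?b"
    using b by (simp add: field_simps)
  with Suc.IH show ?case by simp
qed

text \<open>Splitting off the factor \<open>real k powr (1/2 - s)\<close>, which is at most its
  value at \<open>m\<close>, reduces the sum to the square root case. This makes the constant 2
  uniform in \<open>s\<close>; the intended value is \<open>s\<close> = 1/d with d \<ge> 2.\<close>

lemma sum_powr_minus_le:
  fixes s :: real
  assumes "s \<le> 1/2"
  shows "(\<Sum>k = 1..m. real k powr (- s)) \<le> 2 * real m powr (1 - s)"
proof (cases "m = 0")
  case True
  then show ?thesis by simp
next
  case False
  have "(\<Sum>k = 1..m. real k powr (- s)) \<le> (\<Sum>k = 1..m. real m powr (1/2 - s) * (1 / sqrt (real k)))"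
  proof (rule sum_mono)
    fix k assume k: "k \<in> {1..m}"
    have "real k powr (- s) = real k powr (1/2 - s) * real k powr (- (1/2))"
      by (simp flip: powr_add)
    also have "real k powr (- (1/2)) = 1 / sqrt (real k)"
      by (simp add: powr_minus powr_half_sqrt field_simps)
    also have "real k powr (1/2 - s) * (1 / sqrt (real k))
        \<le> real m powr (1/2 - s) * (1 / sqrt (real k))"
      using k assms by (intro mult_right_mono powr_mono2) auto
    finally show "real k powr (- s) \<le> real m powr (1/2 - s) * (1 / sqrt (real k))" .
  qed
  also have "\<dots> = real m powr (1/2 - s) * (\<Sum>k = 1..m. 1 / sqrt (real k))"
    by (simp add: sum_distrib_left)
  also have "\<dots> \<le> real m powr (1/2 - s) * (2 * sqrt (real m))"
    by (intro mult_left_mono sum_inverse_sqrt_le) simp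
  also have "\<dots> = 2 * (real m powr (1/2 - s) * real m powr (1/2))"
    by (simp add: powr_half_sqrt)
  also have "\<dots> = 2 * real m powr (1 - s)"
    by (simp flip: powr_add)
  finally show ?thesis .
qed

section \<open>Sums weighted by differences of d-th powers\<close>

lemma mult_power_diff_le:
  fixes x y :: real
  assumes "0 \<le> y" "y \<le> x"
  shows "x ^ d * (x - y) \<le> x ^ Suc d - y ^ Suc d"
proof -
  have "y ^ d * y \<le> x ^ d * y"
    using assms by (intro mult_right_mono power_mono) auto
  then show ?thesis by (simp add: algebra_simps)
qed

lemma sum_power_diff_powr_le:
  assumes "d \<ge> 2"
  shows "(\<Sum>n = 1..N. (1 + \<bar>real (Suc N) ^ d - real n ^ d\<bar>) powr (- (1 / real d))) \<le> 2"
proof -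
  define s where "s = 1 / real d"
  define M where "M = real (Suc N)"
  have s: "0 \<le> s" "s \<le> 1/2" and M: "M > 0"
    using assms by (auto simp: s_def M_def field_simps)
  obtain e where e: "d = Suc e" using assms by (cases d) auto
  \<comment> \<open>With \<open>e\<close> = d - 1, the factor \<open>M ^ e\<close> in the lower
    bound for the difference of powers contributes exactly the reciprocal of
    \<open>M powr (1 - s)\<close>, the order of growth of the sum over \<open>M - n\<close>.\<close>
  have "real e * s = 1 - s" unfolding s_def e by (simp add: field_simps)
  then have Me: "(M ^ e) powr (- s) = M powr (- (1 - s))"
    using M by (simp add: powr_powr flip: powr_realpow)
  have "(\<Sum>n = 1..N. (1 + \<bar>M ^ d - real n ^ d\<bar>) powr (- s))
      \<le> (\<Sum>n = 1..N. M powr (- (1 - s)) * real (Suc N - n) powr (- s))"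
  proof (rule sum_mono)
    fix n assume n: "n \<in> {1..N}"
    then have nM: "real n < M" by (simp add: M_def)
    have "(1 + \<bar>M ^ d - real n ^ d\<bar>) powr (- s) \<le> (M ^ e * (M - real n)) powr (- s)"
      using nM M s mult_power_diff_le[of "real n" M e]
      by (intro powr_mono2') (auto simp: e)
    also have "\<dots> = M powr (- (1 - s)) * real (Suc N - n) powr (- s)"
    proof -
      have "M - real n = real (Suc N - n)" using n by (simp add: M_def)
      then show ?thesis by (simp only: powr_mult Me)
    qed
    finally show "(1 + \<bar>M ^ d - real n ^ d\<bar>) powr (- s)
        \<le> M powr (- (1 - s)) * real (Suc N - n) powr (- s)" .
  qed
  \<comment> \<open>The substitution n -> N + 1 - n maps 1..N to itself, so the gaps become the
    summation variable.\<close>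
  also have "\<dots> = M powr (- (1 - s)) * (\<Sum>n = 1..N. real n powr (- s))"
    using sum.atLeastAtMost_rev[of "\<lambda>n. real n powr (- s)" 1 N] by (simp add: sum_distrib_left)
  also have "\<dots> \<le> M powr (- (1 - s)) * (2 * M powr (1 - s))"
  proof (intro mult_left_mono)
    have "(\<Sum>n = 1..N. real n powr (- s)) \<le> 2 * real N powr (1 - s)"
      by (rule sum_powr_minus_le) (use s in auto)
    also have "\<dots> \<le> 2 * M powr (1 - s)"
      using s by (intro mult_left_mono powr_mono2) (auto simp: M_def)
    finally show "(\<Sum>n = 1..N. real n powr (- s)) \<le> 2 * M powr (1 - s)" .
  qed simp
  also have "\<dots> = 2 * M powr (- (1 - s) + (1 - s))"
    by (simp only: powr_add mult_ac)
  also have "\<dots> = 2"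
    using M by simp
  finally show ?thesis by (simp add: s_def M_def)
qed

text \<open>Passing from N to N + 1 adds the pairs with maximum N + 1: a row and a column, equal by
  symmetry and at most 2 each, and a diagonal entry equal to 1. Hence the constant 5.\<close>

lemma double_sum_power_diff_powr_le:
  assumes "d \<ge> 2"
  shows "(\<Sum>m = 1..N. \<Sum>n = 1..N. (1 + \<bar>real m ^ d - real n ^ d\<bar>) powr (- (1 / real d))) \<le> 5 * real N"
proof (induction N)
  case 0
  show ?case by simp
next
  case (Suc N)
  define w where "w m n = (1 + \<bar>real m ^ d - real n ^ d\<bar>) powr (- (1 / real d))" for m n
  have sym: "w m n = w n m" for m n
    by (simp add: w_def abs_minus_commute)
  have "w (Suc N) (Suc N) = 1" by (simp add: w_def)
  moreover have "(\<Sum>n = 1..N. w (Suc N) n) \<le> 2"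
    unfolding w_def by (rule sum_power_diff_powr_le[OF assms])
  moreover have "(\<Sum>m = 1..Suc N. \<Sum>n = 1..Suc N. w m n)
      = (\<Sum>m = 1..N. \<Sum>n = 1..N. w m n) + (\<Sum>n = 1..N. w n (Suc N))
        + (\<Sum>n = 1..N. w (Suc N) n) + w (Suc N) (Suc N)"
    by (simp add: sum.distrib)
  moreover have "(\<Sum>n = 1..N. w n (Suc N)) = (\<Sum>n = 1..N. w (Suc N) n)"
    by (intro sum.cong refl sym)
  moreover have "(\<Sum>m = 1..N. \<Sum>n = 1..N. w m n) \<le> 5 * real N"
    unfolding w_def by (rule Suc.IH)
  ultimately have "(\<Sum>m = 1..Suc N. \<Sum>n = 1..Suc N. w m n) \<le> 5 * real N + 2 + 2 + 1"
    by (metis add_mono order.refl)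
  also have "\<dots> = 5 * real (Suc N)"
    by simp
  finally show ?case by (simp only: w_def)
qed

section \<open>Second moments of exponential sums\<close>

lemma unit_exp_add: "unit_exp (x + y) = unit_exp x * unit_exp y"
  by (simp add: unit_exp_def algebra_simps flip: exp_add)

lemma unit_exp_altdef: "unit_exp x = cis (2 * pi * x)"
  by (simp add: unit_exp_def cis_conv_exp mult_ac)

lemma norm_unit_exp [simp]: "cmod (unit_exp x) = 1"
  by (simp add: unit_exp_altdef)

lemma cnj_unit_exp: "cnj (unit_exp x) = unit_exp (- x)"
  by (simp add: unit_exp_altdef cis_cnj)

lemma integrable_unit_exp_inner:
  fixes \<mu> :: "(real ^ 'd) measure"
  assumes "finite_measure \<mu>" and [measurable_cong]: "sets \<mu> = sets borel"
  shows "integrable \<mu> (\<lambda>x. unit_exp (- (x \<bullet> \<xi>)))"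
proof -
  interpret finite_measure \<mu> by fact
  show ?thesis
  proof (rule integrable_const_bound[where B = 1])
    have "(\<lambda>x. unit_exp (- (x \<bullet> \<xi>))) \<in> borel_measurable borel"
      unfolding unit_exp_def by (intro borel_measurable_continuous_onI continuous_intros)
    then show "(\<lambda>x. unit_exp (- (x \<bullet> \<xi>))) \<in> borel_measurable \<mu>"
      by measurable
  qed simp
qed

text \<open>Writing the square as S times its conjugate gives exponentials with frequency
  \<open>v m - v n\<close>; the minus sign in the Fourier transform turns this into the argument
  \<open>v n - v m\<close>. The identity is stated over the complex numbers because the single terms
  need not be real.\<close>

lemma
  fixes \<mu> :: "(real ^ 'd) measure" and v :: "'n \<Rightarrow> real ^ 'd"
    and A :: "'n set" and a :: "'n \<Rightarrow> complex"
  assumes fin: "finite_measure \<mu>" and sets: "sets \<mu> = sets borel"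
  defines "S \<equiv> \<lambda>x. \<Sum>n\<in>A. a n * unit_exp (x \<bullet> v n)"
  shows integrable_norm_exp_sum_sq: "integrable \<mu> (\<lambda>x. (cmod (S x))\<^sup>2)"
    and integral_norm_exp_sum_sq:
      "complex_of_real (LINT x|\<mu>. (cmod (S x))\<^sup>2)
        = (\<Sum>m\<in>A. \<Sum>n\<in>A. a m * cnj (a n) * fourier_transform \<mu> (v n - v m))"
proof -
  have int: "integrable \<mu> (\<lambda>x. a m * cnj (a n) * unit_exp (- (x \<bullet> (v n - v m))))" for m n
    by (intro integrable_mult_right integrable_unit_exp_inner fin sets)
  have expand: "complex_of_real ((cmod (S x))\<^sup>2)
      = (\<Sum>m\<in>A. \<Sum>n\<in>A. a m * cnj (a n) * unit_exp (- (x \<bullet> (v n - v m))))" for x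
  proof -
    have "unit_exp (x \<bullet> v m) * unit_exp (- (x \<bullet> v n)) = unit_exp (- (x \<bullet> (v n - v m)))" for m n
      by (simp add: inner_diff_right flip: unit_exp_add)
    then show ?thesis
      unfolding complex_norm_square S_def
      by (simp add: sum_product cnj_unit_exp mult_ac)
  qed
  have "integrable \<mu> (\<lambda>x. complex_of_real ((cmod (S x))\<^sup>2))"
    unfolding expand by (intro Bochner_Integration.integrable_sum int)
  then show "integrable \<mu> (\<lambda>x. (cmod (S x))\<^sup>2)"
    by (simp only: complex_of_real_integrable_eq)
  have "complex_of_real (LINT x|\<mu>. (cmod (S x))\<^sup>2) = (LINT x|\<mu>. complex_of_real ((cmod (S x))\<^sup>2))"
    by (simp only: integral_complex_of_real)
  also have "\<dots> = (\<Sum>m\<in>A. \<Sum>n\<in>A. a m * cnj (a n) * fourier_transform \<mu> (v n - v m))"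
    unfolding expand fourier_transform_def
    by (simp add: Bochner_Integration.integral_sum Bochner_Integration.integrable_sum int del: inner_diff_right)
  finally show "complex_of_real (LINT x|\<mu>. (cmod (S x))\<^sup>2)
        = (\<Sum>m\<in>A. \<Sum>n\<in>A. a m * cnj (a n) * fourier_transform \<mu> (v n - v m))" .
qed

section \<open>Trading constants for small powers\<close>

lemma is_pow_o1_bound:
  assumes "is_pow_o1 a" "\<epsilon> > 0"
  obtains K where "K > 0" "\<And>n. n \<ge> 1 \<Longrightarrow> cmod (a n) \<le> K * real n powr \<epsilon>"
proof -
  obtain n0 where n0: "\<And>n. n \<ge> n0 \<Longrightarrow> cmod (a n) \<le> real n powr \<epsilon>"
    using assms unfolding is_pow_o1_def eventually_sequentially by blast
  \<comment> \<open>The sum covers the finitely many indices below \<open>n0\<close>, where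
    \<open>real n powr \<epsilon>\<close> is at least 1; the summand 1 covers the tail.\<close>
  define K where "K = 1 + (\<Sum>n<n0. cmod (a n))"
  have K: "K \<ge> 1" by (simp add: K_def sum_nonneg)
  show ?thesis
  proof
    show "K > 0" using K by simp
    fix n :: nat assume n: "n \<ge> 1"
    have p: "real n powr \<epsilon> \<ge> 1"
      using n assms by (intro ge_one_powr_ge_zero) auto
    show "cmod (a n) \<le> K * real n powr \<epsilon>"
    proof (cases "n < n0")
      case True
      then have "cmod (a n) \<le> (\<Sum>n<n0. cmod (a n))"
        by (intro member_le_sum) auto
      then have "cmod (a n) \<le> K * 1" by (simp add: K_def)
      also have "\<dots> \<le> K * real n powr \<epsilon>" using p K by (intro mult_left_mono) auto
      finally show ?thesis .
    next
      case False
      then have "cmod (a n) \<le> 1 * real n powr \<epsilon>" using n0 by simp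
      also have "\<dots> \<le> K * real n powr \<epsilon>" using K by (intro mult_right_mono) auto
      finally show ?thesis .
    qed
  qed
qed

text \<open>As \<open>real N powr (- \<delta>)\<close> tends to 0, its product with \<open>B\<close>
  is eventually below 1.\<close>

lemma eventually_const_mult_powr_le:
  fixes B c \<delta> :: real
  assumes "\<delta> > 0"
  shows "\<forall>\<^sub>F N in sequentially. B * real N powr c \<le> real N powr (c + \<delta>)"
proof -
  have "(\<lambda>N. B * real N powr (- \<delta>)) \<longlonglongrightarrow> B * 0"
    using assms by (intro tendsto_mult_left tendsto_neg_powr filterlim_real_sequentially) auto
  then have "\<forall>\<^sub>F N in sequentially. B * real N powr (- \<delta>) < 1"
    by (rule order_tendstoD) simp
  then show ?thesis
  proof eventually_elim
    case (elim N)
    have "B * real N powr c = B * real N powr (- \<delta>) * real N powr (c + \<delta>)"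
      by (simp add: mult.assoc flip: powr_add)
    also have "\<dots> \<le> 1 * real N powr (c + \<delta>)"
      using elim by (intro mult_right_mono) auto
    finally show ?case by simp
  qed
qed

section \<open>The mean square of Weyl sums\<close>

theorem theorem2p1:
  fixes \<mu> :: "(real ^ 'd) measure"
    and idx :: "nat \<Rightarrow> 'd"
    and \<sigma> :: real
    and a :: "nat \<Rightarrow> complex"
  assumes "CARD('d) \<ge> 2"
    and "bij_betw idx {1..CARD('d)} UNIV"
    and "radon_measure_on_torus \<mu>"
    and "\<sigma> \<ge> 1 / real CARD('d)"
    and "\<exists>C>0. \<forall>\<xi>. cmod (fourier_transform \<mu> \<xi>) \<le> C * (1 + norm \<xi>) powr (- \<sigma>)"
    and "is_pow_o1 a"
  shows "le_pow_plus_o1 (\<lambda>N. LINT x:unit_cube|\<mu>. (cmod (weyl_sum idx a x N))\<^sup>2) 1"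
  unfolding le_pow_plus_o1_def
proof (intro allI impI)
  fix \<epsilon> :: real assume \<epsilon>: "\<epsilon> > 0"
  define d where "d = CARD('d)"
  \<comment> \<open>The point (n, ..., n^d) of the moment curve, with coordinates placed according
    to \<open>idx\<close>, so that the phase of the Weyl sum is
    \<open>x \<bullet> v n\<close>.\<close>
  define v :: "nat \<Rightarrow> real ^ 'd" where
    "v n = (\<chi> i. real n ^ inv_into {1..d} idx i)" for n
  have sets: "sets \<mu> = sets borel" and fin: "finite_measure \<mu>"
    using assms(3) by (auto simp: radon_measure_on_torus_def sets_eq_imp_space_eq intro!: finite_measureI)
  obtain C where C: "C > 0" "\<And>\<xi>. cmod (fourier_transform \<mu> \<xi>) \<le> C * (1 + norm \<xi>) powr (- \<sigma>)"
    using assms(5) by blast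
  \<comment> \<open>Two coefficients occur in each term of the expanded square, so \<epsilon>/4
    costs \<epsilon>/2 in total; the other \<epsilon>/2 is kept to absorb the constants.\<close>
  obtain K where K: "K > 0" "\<And>n. n \<ge> 1 \<Longrightarrow> cmod (a n) \<le> K * real n powr (\<epsilon> / 4)"
    using is_pow_o1_bound[OF assms(6), of "\<epsilon> / 4"] \<epsilon> by auto

  have inv: "inv_into {1..d} idx (idx j) = j" if "j \<in> {1..d}" for j
    using assms(2) that by (simp add: bij_betw_def d_def)
  have weyl: "weyl_sum idx a x N = (\<Sum>n = 1..N. a n * unit_exp (x \<bullet> v n))" for x N
  proof -
    have "x \<bullet> v n = (\<Sum>j = 1..d. x $ idx j * real n ^ j)" for n
    proof -
      have "x \<bullet> v n = (\<Sum>i\<in>UNIV. x $ i * real n ^ inv_into {1..d} idx i)"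
        by (simp add: inner_vec_def v_def)
      also have "\<dots> = (\<Sum>j = 1..d. x $ idx j * real n ^ inv_into {1..d} idx (idx j))"
        unfolding d_def by (rule sum.reindex_bij_betw[OF assms(2), symmetric])
      finally show ?thesis using inv by simp
    qed
    then show ?thesis by (simp add: weyl_sum_def d_def)
  qed

  have ft: "cmod (fourier_transform \<mu> (v n - v m))
      \<le> C * (1 + \<bar>real m ^ d - real n ^ d\<bar>) powr (- (1 / real d))" for m n
  proof -
    have "d \<in> {1..d}" using assms(1) by (simp add: d_def)
    then have "\<bar>real m ^ d - real n ^ d\<bar> = \<bar>(v n - v m) $ idx d\<bar>"
      using inv[of d] by (simp add: v_def abs_minus_commute)
    also have "\<dots> \<le> norm (v n - v m)" by (rule component_le_norm_cart)
    finally have le: "\<bar>real m ^ d - real n ^ d\<bar> \<le> norm (v n - v m)" .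
    \<comment> \<open>The base is at least 1, so the decay exponent may be lowered from \<sigma> to
      1/d; then the norm is replaced by its last-coordinate lower bound.\<close>
    have "(1 + norm (v n - v m)) powr (- \<sigma>) \<le> (1 + norm (v n - v m)) powr (- (1 / real d))"
      using assms(4) by (intro powr_mono) (auto simp: d_def)
    also have "\<dots> \<le> (1 + \<bar>real m ^ d - real n ^ d\<bar>) powr (- (1 / real d))"
      using le by (intro powr_mono2') auto
    finally show ?thesis
      using C(2)[of "v n - v m"] C(1) by (meson mult_left_mono order_trans less_imp_le)
  qed

  have bound: "(LINT x:unit_cube|\<mu>. (cmod (weyl_sum idx a x N))\<^sup>2)
      \<le> 5 * C * K\<^sup>2 * real N powr (1 + \<epsilon> / 2)" if N: "N \<ge> 1" for N
  proof -
    let ?F = "\<lambda>x. (cmod (\<Sum>n = 1..N. a n * unit_exp (x \<bullet> v n)))\<^sup>2"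
    let ?w = "\<lambda>m n. (1 + \<bar>real m ^ d - real n ^ d\<bar>) powr (- (1 / real d))"
    define P where "P = K * real N powr (\<epsilon> / 4)"
    have P: "0 \<le> P" using K(1) by (simp add: P_def)
    have aP: "cmod (a n) \<le> P" if "n \<in> {1..N}" for n
    proof -
      have "cmod (a n) \<le> K * real n powr (\<epsilon> / 4)" using K(2) that by simp
      also have "\<dots> \<le> P"
        unfolding P_def using K(1) \<epsilon> that by (intro mult_left_mono powr_mono2) auto
      finally show ?thesis .
    qed
    \<comment> \<open>The integrand is nonnegative and \<open>?F\<close> is integrable, so the
      integral over the cube is at most that over the whole space, where the Fourier transform is
      defined.\<close>
    have "(LINT x:unit_cube|\<mu>. (cmod (weyl_sum idx a x N))\<^sup>2) \<le> (LINT x|\<mu>. ?F x)"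
      unfolding weyl set_lebesgue_integral_def
      by (intro integral_mono' integrable_norm_exp_sum_sq fin sets)
         (auto simp: indicator_def)
    \<comment> \<open>Taking the modulus allows the triangle inequality to be applied to the complex
      double sum.\<close>
    also have "\<dots> \<le> cmod (complex_of_real (LINT x|\<mu>. ?F x))"
      by simp
    also have "\<dots> = cmod (\<Sum>m = 1..N. \<Sum>n = 1..N. a m * cnj (a n) * fourier_transform \<mu> (v n - v m))"
      by (simp only: integral_norm_exp_sum_sq[OF fin sets])
    also have "\<dots> \<le> (\<Sum>m = 1..N. \<Sum>n = 1..N. P * P * (C * ?w m n))"
      using P
      by (intro sum_norm_le) (auto simp: norm_mult intro!: mult_mono aP ft)
    also have "\<dots> = P * P * C * (\<Sum>m = 1..N. \<Sum>n = 1..N. ?w m n)"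
      by (simp add: sum_distrib_left mult.assoc)
    also have "\<dots> \<le> P * P * C * (5 * real N)"
      using assms(1) P C(1)
      by (intro mult_left_mono double_sum_power_diff_powr_le) (auto simp: d_def)
    also have "\<dots> = 5 * C * K\<^sup>2 * (real N powr 1 * (real N powr (\<epsilon> / 4) * real N powr (\<epsilon> / 4)))"
      by (simp add: P_def power2_eq_square mult_ac)
    also have "real N powr 1 * (real N powr (\<epsilon> / 4) * real N powr (\<epsilon> / 4)) = real N powr (1 + \<epsilon> / 2)"
      by (simp only: flip: powr_add) simp
    finally show ?thesis .
  qed
  have "\<forall>\<^sub>F N in sequentially.
      5 * C * K\<^sup>2 * real N powr (1 + \<epsilon> / 2) \<le> real N powr (1 + \<epsilon> / 2 + \<epsilon> / 2)"
    using \<epsilon> by (intro eventually_const_mult_powr_le) simp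
  then show "\<forall>\<^sub>F N in sequentially.
      (LINT x:unit_cube|\<mu>. (cmod (weyl_sum idx a x N))\<^sup>2) \<le> real N powr (1 + \<epsilon>)"
    using eventually_ge_at_top[of 1]
  proof eventually_elim
    case (elim N)
    have "1 + \<epsilon> / 2 + \<epsilon> / 2 = 1 + \<epsilon>" by simp
    then show ?case
      using order_trans[OF bound[OF elim(2)] elim(1)] by (simp only:)
  qed
qed

end
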